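(* Let $\varphi\colon C^1([0,1])\to\mathbb{C}$ be a (not necessarily linear) multiplicative spectral function. Then the following statements are equivalent: (i) $\varphi$ is a character. (ii) $\varphi$ is continuous. (iii) $1\notin\mathrm{span}(\ker(\varphi))$.
   Context: $C^1([0,1])$ is the Banach algebra of continuously differentiable complex-valued functions on $[0,1]$ with norm $\|f\|=\|f\|_{[0,1]}+\|f'\|_{[0,1]}$, where $\|\cdot\|_{[0,1]}$ is the supremum norm. A function $\varphi\colon A\to\mathbb{C}$ on a Banach algebra $A$ is spectral if $\varphi(f)\in\sigma(f)$ for all $f\in A$, where $\sigma(f)$ is the spectrum of $f$ in $A$, and multiplicative if $\varphi(fg)=\varphi(f)\varphi(g)$ for all $f,g\in A$. Here $\ker(\varphi)=\{f\in A:\varphi(f)=0\}$, and $\mathrm{span}$ is the complex linear span. A character is a nonzero multiplicative complex-linear functional. Continuity is with respect to the norm of $A$. *)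

theory Defs
  imports "HOL-Analysis.Analysis"
begin

class scaleC =
  fixes scaleC :: "complex \<Rightarrow> 'a \<Rightarrow> 'a"  (infixr \<open>*\<^sub>C\<close> 75)

class complex_banach_algebra_1 = real_normed_algebra_1 + banach + scaleC +
  assumes scaleC_add_right: "a *\<^sub>C (x + y) = a *\<^sub>C x + a *\<^sub>C y"
    and scaleC_add_left: "(a + b) *\<^sub>C x = a *\<^sub>C x + b *\<^sub>C x"
    and scaleC_scaleC: "a *\<^sub>C (b *\<^sub>C x) = (a * b) *\<^sub>C x"
    and scaleR_scaleC: "r *\<^sub>R x = complex_of_real r *\<^sub>C x"
    and mult_scaleC_left: "(a *\<^sub>C x) * y = a *\<^sub>C (x * y)"
    and mult_scaleC_right: "x * (a *\<^sub>C y) = a *\<^sub>C (x * y)"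
    and norm_scaleC: "norm (a *\<^sub>C x) = cmod a * norm x"

lemma vector_space_scaleC:
  "vector_space (scaleC :: complex \<Rightarrow> 'a::complex_banach_algebra_1 \<Rightarrow> 'a)"
proof
  fix x :: 'a
  show "1 *\<^sub>C x = x"
    using scaleR_scaleC[of 1 x] by simp
qed (simp_all add: scaleC_add_right scaleC_add_left scaleC_scaleC)

global_interpretation complex_vector:
    vector_space "scaleC :: complex \<Rightarrow> 'a::complex_banach_algebra_1 \<Rightarrow> 'a"
  defines cspan = complex_vector.span
  by (rule vector_space_scaleC)

definition spectrum :: "'a::complex_banach_algebra_1 \<Rightarrow> complex set" where
  "spectrum x =
     {z. \<not> (\<exists>y. (x - z *\<^sub>C 1) * y = 1 \<and> y * (x - z *\<^sub>C 1) = 1)}"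

definition spectral :: "('a::complex_banach_algebra_1 \<Rightarrow> complex) \<Rightarrow> bool" where
  "spectral \<phi> \<longleftrightarrow> (\<forall>x. \<phi> x \<in> spectrum x)"

definition multiplicative :: "('a::complex_banach_algebra_1 \<Rightarrow> complex) \<Rightarrow> bool" where
  "multiplicative \<phi> \<longleftrightarrow> (\<forall>x y. \<phi> (x * y) = \<phi> x * \<phi> y)"

definition ker :: "('a::complex_banach_algebra_1 \<Rightarrow> complex) \<Rightarrow> 'a set" where
  "ker \<phi> = {x. \<phi> x = 0}"

definition character :: "('a::complex_banach_algebra_1 \<Rightarrow> complex) \<Rightarrow> bool" where
  "character \<phi> \<longleftrightarrow>
     Vector_Spaces.linear scaleC (*) \<phi> \<and> multiplicative \<phi> \<and> (\<exists>x. \<phi> x \<noteq> 0)"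


text \<open>
  Derivatives are taken relative to \<open>{0..1}\<close>, hence are one-sided at the endpoints. (The library's
  \<open>C1_differentiable_on\<close> uses two-sided derivatives, which depend on the values outside
  the interval.)
\<close>

definition deriv01 :: "(real \<Rightarrow> complex) \<Rightarrow> real \<Rightarrow> complex" where
  "deriv01 f x = vector_derivative f (at x within {0..1})"

definition C1_on01 :: "(real \<Rightarrow> complex) \<Rightarrow> bool" where
  "C1_on01 f \<longleftrightarrow>
     (\<forall>x\<in>{0..1}. f differentiable (at x within {0..1})) \<and> continuous_on {0..1} (deriv01 f)"

lemma C1_on01_has_deriv:
  assumes "C1_on01 f" "x \<in> {0..1}"
  shows "(f has_vector_derivative deriv01 f x) (at x within {0..1})"
  using assms unfolding C1_on01_def deriv01_def by (simp add: vector_derivative_works[symmetric])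

lemma deriv01_eqI:
  assumes "x \<in> {0..1}" "(f has_vector_derivative d) (at x within {0..1})"
  shows "deriv01 f x = d"
  unfolding deriv01_def using assms by (intro vector_derivative_within_closed_interval) auto

lemma C1_on01I:
  assumes "\<And>x. x \<in> {0..1} \<Longrightarrow> (f has_vector_derivative d x) (at x within {0..1})"
    and "continuous_on {0..1} d"
  shows "C1_on01 f"
proof -
  have "continuous_on {0..1} (deriv01 f)"
    using assms(2) by (rule continuous_on_eq) (simp add: deriv01_eqI[OF _ assms(1)])
  then show ?thesis
    unfolding C1_on01_def using assms(1) differentiableI_vector by blast
qed

lemma C1_on01_continuous: "C1_on01 f \<Longrightarrow> continuous_on {0..1} f"
  by (metis C1_on01_has_deriv continuous_on_vector_derivative)

lemma C1_on01_continuous_deriv: "C1_on01 f \<Longrightarrow> continuous_on {0..1} (deriv01 f)"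
  by (simp add: C1_on01_def)

text \<open>
  A function on \<open>[0,1]\<close> is represented by its extension by zero to the real line, so that equality
  in the type below is equality on \<open>[0,1]\<close>.
\<close>

typedef c1 = "{f :: real \<Rightarrow> complex. C1_on01 f \<and> (\<forall>x. x \<notin> {0..1} \<longrightarrow> f x = 0)}"
  morphisms apply_c1 Abs_c1
proof
  show "(\<lambda>x. 0) \<in> {f. C1_on01 f \<and> (\<forall>x. x \<notin> {0..1} \<longrightarrow> f x = 0)}"
    by (auto intro!: C1_on01I[where d = "\<lambda>x. 0"])
qed

setup_lifting type_definition_c1

lemma has_vector_derivative_extend0:
  fixes f :: "real \<Rightarrow> complex"
  assumes "x \<in> {0..1}" "(f has_vector_derivative d) (at x within {0..1})"
  shows "((\<lambda>x. if x \<in> {0..1} then f x else 0) has_vector_derivative d) (at x within {0..1})"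
  using assms(1) _ assms(2) by (rule has_vector_derivative_transform) simp

instantiation c1 :: comm_ring_1
begin

lift_definition zero_c1 :: c1 is "\<lambda>x. 0"
  by (auto intro!: C1_on01I[where d = "\<lambda>x. 0"])

lift_definition one_c1 :: c1 is "\<lambda>x. if x \<in> {0..1} then 1 else 0"
  by (auto intro!: C1_on01I[where d = "\<lambda>x. 0"] has_vector_derivative_extend0[simplified])

lift_definition plus_c1 :: "c1 \<Rightarrow> c1 \<Rightarrow> c1" is "\<lambda>f g x. f x + g x"
proof safe
  fix f g :: "real \<Rightarrow> complex"
  assume *: "C1_on01 f" "C1_on01 g"
  show "C1_on01 (\<lambda>x. f x + g x)"
    by (rule C1_on01I[where d = "\<lambda>x. deriv01 f x + deriv01 g x"])
      (auto intro!: * has_vector_derivative_add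
        continuous_on_add C1_on01_has_deriv C1_on01_continuous_deriv)
qed simp

lift_definition uminus_c1 :: "c1 \<Rightarrow> c1" is "\<lambda>f x. - f x"
proof safe
  fix f :: "real \<Rightarrow> complex"
  assume *: "C1_on01 f"
  show "C1_on01 (\<lambda>x. - f x)"
    by (rule C1_on01I[where d = "\<lambda>x. - deriv01 f x"])
      (auto intro!: * has_vector_derivative_minus
        continuous_on_minus C1_on01_has_deriv C1_on01_continuous_deriv)
qed simp

lift_definition minus_c1 :: "c1 \<Rightarrow> c1 \<Rightarrow> c1" is "\<lambda>f g x. f x - g x"
proof safe
  fix f g :: "real \<Rightarrow> complex"
  assume *: "C1_on01 f" "C1_on01 g"
  show "C1_on01 (\<lambda>x. f x - g x)"
    by (rule C1_on01I[where d = "\<lambda>x. deriv01 f x - deriv01 g x"])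
      (auto intro!: * has_vector_derivative_diff
        continuous_on_diff C1_on01_has_deriv C1_on01_continuous_deriv)
qed simp

lift_definition times_c1 :: "c1 \<Rightarrow> c1 \<Rightarrow> c1" is "\<lambda>f g x. f x * g x"
proof safe
  fix f g :: "real \<Rightarrow> complex"
  assume *: "C1_on01 f" "C1_on01 g"
  show "C1_on01 (\<lambda>x. f x * g x)"
    by (rule C1_on01I[where d = "\<lambda>x. f x * deriv01 g x + deriv01 f x * g x"])
      (auto intro!: * has_vector_derivative_mult continuous_on_add continuous_on_mult
        C1_on01_has_deriv *[THEN C1_on01_continuous_deriv] *[THEN C1_on01_continuous])
qed simp

instance
proof
  show "(0::c1) \<noteq> 1"
    by transfer (auto simp: fun_eq_iff intro!: exI[of _ 0])
qed (transfer; auto simp: fun_eq_iff algebra_simps)+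

end

instantiation c1 :: scaleC
begin

lift_definition scaleC_c1 :: "complex \<Rightarrow> c1 \<Rightarrow> c1" is "\<lambda>a f x. a * f x"
proof safe
  fix f :: "real \<Rightarrow> complex" and a :: complex
  assume *: "C1_on01 f"
  show "C1_on01 (\<lambda>x. a * f x)"
    by (rule C1_on01I[where d = "\<lambda>x. a * deriv01 f x"])
      (auto intro!: * has_vector_derivative_mult_right
        continuous_on_mult continuous_on_const C1_on01_has_deriv C1_on01_continuous_deriv)
qed simp

instance ..

end

definition supnorm01 :: "(real \<Rightarrow> complex) \<Rightarrow> real" where
  "supnorm01 f = (SUP x\<in>{0..1}. cmod (f x))"

lemma supnorm01_upper:
  assumes "continuous_on {0..1} f" "x \<in> {0..1}"
  shows "cmod (f x) \<le> supnorm01 f"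
proof -
  have "compact ((\<lambda>x. cmod (f x)) ` {0..1})"
    using assms(1) by (intro compact_continuous_image continuous_on_norm) auto
  then have "bdd_above ((\<lambda>x. cmod (f x)) ` {0..1})"
    by (intro bounded_imp_bdd_above compact_imp_bounded)
  then show ?thesis
    unfolding supnorm01_def using assms(2) by (rule cSUP_upper[rotated])
qed

lemma supnorm01_least:
  assumes "\<And>x. x \<in> {0..1} \<Longrightarrow> cmod (f x) \<le> b"
  shows "supnorm01 f \<le> b"
  unfolding supnorm01_def using assms by (intro cSUP_least) auto

lemma supnorm01_nonneg:
  assumes "continuous_on {0..1} f"
  shows "0 \<le> supnorm01 f"
  using order_trans[OF norm_ge_zero supnorm01_upper[OF assms, of 0]] by simp

lemma supnorm01_triangle:
  assumes "continuous_on {0..1} f" "continuous_on {0..1} g"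
  shows "supnorm01 (\<lambda>x. f x + g x) \<le> supnorm01 f + supnorm01 g"
  using supnorm01_upper[OF assms(1)] supnorm01_upper[OF assms(2)]
  by (intro supnorm01_least) (meson add_mono norm_triangle_ineq order_trans)

lemma supnorm01_mult:
  assumes "continuous_on {0..1} f" "continuous_on {0..1} g"
  shows "supnorm01 (\<lambda>x. f x * g x) \<le> supnorm01 f * supnorm01 g"
  using supnorm01_upper[OF assms(1)] supnorm01_upper[OF assms(2)] supnorm01_nonneg[OF assms(1)]
  by (intro supnorm01_least) (simp add: norm_mult mult_mono)

lemma supnorm01_cong:
  assumes "\<And>x. x \<in> {0..1} \<Longrightarrow> f x = g x"
  shows "supnorm01 f = supnorm01 g"
  unfolding supnorm01_def using assms by (intro SUP_cong) auto

lemma supnorm01_cmult: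
  assumes "continuous_on {0..1} f"
  shows "supnorm01 (\<lambda>x. a * f x) = cmod a * supnorm01 f"
proof (rule antisym)
  show "supnorm01 (\<lambda>x. a * f x) \<le> cmod a * supnorm01 f"
    using supnorm01_upper[OF assms]
    by (intro supnorm01_least) (simp add: norm_mult mult_left_mono)
  show "cmod a * supnorm01 f \<le> supnorm01 (\<lambda>x. a * f x)"
  proof (cases "a = 0")
    case True
    then show ?thesis
      using supnorm01_nonneg[of "\<lambda>x. a * f x"] by simp
  next
    case False
    have "continuous_on {0..1} (\<lambda>x. a * f x)"
      using assms by (intro continuous_intros)
    from supnorm01_upper[OF this] False have "supnorm01 f \<le> supnorm01 (\<lambda>x. a * f x) / cmod a"
      by (intro supnorm01_least) (simp add: norm_mult field_simps)
    with False show ?thesis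
      by (simp add: field_simps)
  qed
qed

instantiation c1 :: real_vector
begin

definition scaleR_c1 :: "real \<Rightarrow> c1 \<Rightarrow> c1" where
  "scaleR_c1 r f = complex_of_real r *\<^sub>C f"

instance
  by standard (unfold scaleR_c1_def; transfer; simp add: fun_eq_iff algebra_simps)+

end

instantiation c1 :: real_normed_algebra_1
begin

definition norm_c1 :: "c1 \<Rightarrow> real" where
  "norm_c1 f = supnorm01 (apply_c1 f) + supnorm01 (deriv01 (apply_c1 f))"

definition dist_c1 :: "c1 \<Rightarrow> c1 \<Rightarrow> real" where
  "dist_c1 f g = norm (f - g)"

definition sgn_c1 :: "c1 \<Rightarrow> c1" where
  "sgn_c1 f = f /\<^sub>R norm f"

definition uniformity_c1 :: "(c1 \<times> c1) filter" where
  "uniformity_c1 = (INF e\<in>{0<..}. principal {(f, g). dist f g < e})"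

definition open_c1 :: "c1 set \<Rightarrow> bool" where
  "open_c1 U \<longleftrightarrow> (\<forall>f\<in>U. \<forall>\<^sub>F (f', g) in uniformity. f' = f \<longrightarrow> g \<in> U)"

lemma C1_on01_apply: "C1_on01 (apply_c1 f)"
  using apply_c1[of f] by simp

lemma apply_c1_outside: "x \<notin> {0..1} \<Longrightarrow> apply_c1 f x = 0"
  using apply_c1[of f] by auto

lemma continuous_apply_c1: "continuous_on {0..1} (apply_c1 f)"
  by (intro C1_on01_continuous C1_on01_apply)

lemma continuous_deriv_c1: "continuous_on {0..1} (deriv01 (apply_c1 f))"
  by (intro C1_on01_continuous_deriv C1_on01_apply)

lemma has_deriv_c1:
  "x \<in> {0..1} \<Longrightarrow>
     (apply_c1 f has_vector_derivative deriv01 (apply_c1 f) x) (at x within {0..1})"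
  by (intro C1_on01_has_deriv C1_on01_apply)

lemma deriv01_plus:
  "x \<in> {0..1} \<Longrightarrow>
     deriv01 (apply_c1 (f + g)) x = deriv01 (apply_c1 f) x + deriv01 (apply_c1 g) x"
  unfolding plus_c1.rep_eq by (intro deriv01_eqI has_vector_derivative_add has_deriv_c1)

lemma deriv01_minus:
  "x \<in> {0..1} \<Longrightarrow>
     deriv01 (apply_c1 (f - g)) x = deriv01 (apply_c1 f) x - deriv01 (apply_c1 g) x"
  unfolding minus_c1.rep_eq by (intro deriv01_eqI has_vector_derivative_diff has_deriv_c1)

lemma deriv01_times:
  "x \<in> {0..1} \<Longrightarrow>
     deriv01 (apply_c1 (f * g)) x =
       apply_c1 f x * deriv01 (apply_c1 g) x + deriv01 (apply_c1 f) x * apply_c1 g x"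
  unfolding times_c1.rep_eq by (intro deriv01_eqI has_vector_derivative_mult has_deriv_c1)

lemma deriv01_scaleC:
  "x \<in> {0..1} \<Longrightarrow> deriv01 (apply_c1 (a *\<^sub>C f)) x = a * deriv01 (apply_c1 f) x"
  unfolding scaleC_c1.rep_eq by (intro deriv01_eqI has_vector_derivative_mult_right has_deriv_c1)

lemma deriv01_one: "x \<in> {0..1} \<Longrightarrow> deriv01 (apply_c1 1) x = 0"
  unfolding one_c1.rep_eq
  by (intro deriv01_eqI has_vector_derivative_extend0 has_vector_derivative_const)

lemma norm_apply_c1: "x \<in> {0..1} \<Longrightarrow> cmod (apply_c1 f x) \<le> norm f"
  unfolding norm_c1_def
  using supnorm01_upper[OF continuous_apply_c1, of x f] supnorm01_nonneg[OF continuous_deriv_c1, of f]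
  by linarith

lemma norm_deriv01_c1: "x \<in> {0..1} \<Longrightarrow> cmod (deriv01 (apply_c1 f) x) \<le> norm f"
  unfolding norm_c1_def
  using supnorm01_upper[OF continuous_deriv_c1, of x f] supnorm01_nonneg[OF continuous_apply_c1, of f]
  by linarith

lemma norm_c1_le:
  assumes "\<And>x. x \<in> {0..1} \<Longrightarrow> cmod (apply_c1 f x) \<le> a"
    and "\<And>x. x \<in> {0..1} \<Longrightarrow> cmod (deriv01 (apply_c1 f) x) \<le> b"
  shows "norm f \<le> a + b"
  unfolding norm_c1_def using assms by (intro add_mono supnorm01_least)

lemma norm_scaleC_c1: "norm (a *\<^sub>C f) = cmod a * norm (f :: c1)"
proof -
  have "supnorm01 (deriv01 (apply_c1 (a *\<^sub>C f))) = cmod a * supnorm01 (deriv01 (apply_c1 f))"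
    unfolding supnorm01_cmult[OF continuous_deriv_c1, symmetric]
    by (intro supnorm01_cong deriv01_scaleC)
  then show ?thesis
    unfolding norm_c1_def scaleC_c1.rep_eq supnorm01_cmult[OF continuous_apply_c1]
    by (simp add: distrib_left)
qed

instance
proof
  fix f g :: c1 and r :: real and U :: "c1 set"
  show "dist f g = norm (f - g)"
    by (rule dist_c1_def)
  show "sgn f = f /\<^sub>R norm f"
    by (rule sgn_c1_def)
  show "uniformity = (INF e\<in>{0<..}. principal {(f, g :: c1). dist f g < e})"
    by (rule uniformity_c1_def)
  show "open U \<longleftrightarrow> (\<forall>f\<in>U. \<forall>\<^sub>F (f', g) in uniformity. f' = f \<longrightarrow> g \<in> U)"
    by (rule open_c1_def)
  show "r *\<^sub>R f * g = r *\<^sub>R (f * g)" "f * r *\<^sub>R g = r *\<^sub>R (f * g)"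
    unfolding scaleR_c1_def by (transfer; simp add: fun_eq_iff)+
  show "norm (r *\<^sub>R f) = \<bar>r\<bar> * norm f"
    unfolding scaleR_c1_def norm_scaleC_c1 by simp
  show "norm f = 0 \<longleftrightarrow> f = 0"
  proof
    assume "norm f = 0"
    then have "apply_c1 f x = 0" for x
      using norm_apply_c1[of x f] apply_c1_outside[of x f] by (cases "x \<in> {0..1}") auto
    then show "f = 0"
      by (simp add: apply_c1_inject[symmetric] zero_c1.rep_eq fun_eq_iff)
  next
    assume "f = 0"
    then have "f = 0 *\<^sub>C f"
      by transfer simp
    then show "norm f = 0"
      using norm_scaleC_c1[of 0 f] by simp
  qed
  show "norm (f + g) \<le> norm f + norm g"
  proof -
    have "supnorm01 (deriv01 (apply_c1 (f + g)))
            = supnorm01 (\<lambda>x. deriv01 (apply_c1 f) x + deriv01 (apply_c1 g) x)"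
      by (intro supnorm01_cong deriv01_plus)
    also have "\<dots> \<le> supnorm01 (deriv01 (apply_c1 f)) + supnorm01 (deriv01 (apply_c1 g))"
      by (intro supnorm01_triangle continuous_deriv_c1)
    finally show ?thesis
      using supnorm01_triangle[OF continuous_apply_c1[of f] continuous_apply_c1[of g]]
      unfolding norm_c1_def plus_c1.rep_eq by linarith
  qed
  show "norm (f * g) \<le> norm f * norm g"
  proof -
    let ?F = "apply_c1 f" and ?G = "apply_c1 g"
    note cont = continuous_apply_c1 continuous_deriv_c1
    have "supnorm01 (deriv01 (apply_c1 (f * g)))
            = supnorm01 (\<lambda>x. ?F x * deriv01 ?G x + deriv01 ?F x * ?G x)"
      by (intro supnorm01_cong deriv01_times)
    also have "\<dots> \<le> supnorm01 (\<lambda>x. ?F x * deriv01 ?G x) + supnorm01 (\<lambda>x. deriv01 ?F x * ?G x)"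
      by (intro supnorm01_triangle continuous_on_mult cont)
    also have "\<dots> \<le> supnorm01 ?F * supnorm01 (deriv01 ?G) + supnorm01 (deriv01 ?F) * supnorm01 ?G"
      by (intro add_mono supnorm01_mult cont)
    finally have "norm (f * g) \<le> supnorm01 ?F * supnorm01 ?G +
        (supnorm01 ?F * supnorm01 (deriv01 ?G) + supnorm01 (deriv01 ?F) * supnorm01 ?G)"
      using supnorm01_mult[OF continuous_apply_c1[of f] continuous_apply_c1[of g]]
      unfolding norm_c1_def times_c1.rep_eq by linarith
    also have "\<dots> \<le> norm f * norm g"
      using mult_nonneg_nonneg[OF supnorm01_nonneg[OF continuous_deriv_c1[of f]]
          supnorm01_nonneg[OF continuous_deriv_c1[of g]]]
      unfolding norm_c1_def by (simp add: algebra_simps)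
    finally show ?thesis .
  qed
  show "norm (1 :: c1) = 1"
  proof -
    have "supnorm01 (apply_c1 1) = supnorm01 (\<lambda>x. 1)"
      by (intro supnorm01_cong) (simp add: one_c1.rep_eq)
    moreover have "supnorm01 (deriv01 (apply_c1 1)) = supnorm01 (\<lambda>x. 0)"
      by (intro supnorm01_cong deriv01_one)
    ultimately show ?thesis
      by (simp add: norm_c1_def supnorm01_def)
  qed
qed

end

instance c1 :: banach
proof
  fix X :: "nat \<Rightarrow> c1"
  assume X: "Cauchy X"
  let ?D = "\<lambda>n. deriv01 (apply_c1 (X n))"
  have "\<exists>N. \<forall>m n x. N \<le> m \<and> N \<le> n \<and> x \<in> {0..1} \<longrightarrow> dist (?D m x) (?D n x) < e"
    and "\<exists>N. \<forall>m n x. N \<le> m \<and> N \<le> n \<and> x \<in> {0..1} \<longrightarrow>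
           dist (apply_c1 (X m) x) (apply_c1 (X n) x) < e" if e: "e > 0" for e
  proof -
    obtain N where N: "\<And>m n. N \<le> m \<Longrightarrow> N \<le> n \<Longrightarrow> norm (X m - X n) < e"
      using X e unfolding Cauchy_def dist_norm by blast
    have "dist (?D m x) (?D n x) < e" "dist (apply_c1 (X m) x) (apply_c1 (X n) x) < e"
      if "N \<le> m \<and> N \<le> n \<and> x \<in> {0..1}" for m n x
    proof -
      have x: "x \<in> {0..1}"
        using that by blast
      show "dist (?D m x) (?D n x) < e"
        using N[of m n] that norm_deriv01_c1[OF x, of "X m - X n"]
        unfolding deriv01_minus[OF x] dist_norm by linarith
      show "dist (apply_c1 (X m) x) (apply_c1 (X n) x) < e"
        using N[of m n] that norm_apply_c1[OF x, of "X m - X n"]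
        unfolding minus_c1.rep_eq dist_norm by linarith
    qed
    then show "\<exists>N. \<forall>m n x. N \<le> m \<and> N \<le> n \<and> x \<in> {0..1} \<longrightarrow> dist (?D m x) (?D n x) < e"
      and "\<exists>N. \<forall>m n x. N \<le> m \<and> N \<le> n \<and> x \<in> {0..1} \<longrightarrow>
           dist (apply_c1 (X m) x) (apply_c1 (X n) x) < e"
      by blast+
  qed
  then obtain h d
    where h: "\<And>e. e > 0 \<Longrightarrow> \<exists>N. \<forall>n x. N \<le> n \<and> x \<in> {0..1} \<longrightarrow> dist (apply_c1 (X n) x) (h x) < e"
      and d: "\<And>e. e > 0 \<Longrightarrow> \<exists>N. \<forall>n x. N \<le> n \<and> x \<in> {0..1} \<longrightarrow> dist (?D n x) (d x) < e"
    using uniformly_convergent_eq_cauchy[of "\<lambda>x. x \<in> {0..1}" "\<lambda>n. apply_c1 (X n)"]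
      uniformly_convergent_eq_cauchy[of "\<lambda>x. x \<in> {0..1}" ?D] by metis
  have lim_h: "(\<lambda>n. apply_c1 (X n) x) \<longlonglongrightarrow> h x" if "x \<in> {0..1}" for x
    unfolding lim_sequentially using h that by meson
  have "uniform_limit {0..1} ?D d sequentially"
    unfolding uniform_limit_sequentially_iff using d by meson
  then have cont_d: "continuous_on {0..1} d"
    by (rule uniform_limit_theorem[rotated]) (simp_all add: continuous_deriv_c1)
  have "\<exists>g. \<forall>x\<in>{0..1}. (\<lambda>n. apply_c1 (X n) x) \<longlonglongrightarrow> g x \<and>
          (g has_derivative (\<lambda>t. t *\<^sub>R d x)) (at x within {0..1})"
  proof (rule has_derivative_sequence)
    show "(apply_c1 (X n) has_derivative (\<lambda>t. t *\<^sub>R ?D n x)) (at x within {0..1})"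
      if "x \<in> {0..1}" for n x
      using has_deriv_c1[OF that] unfolding has_vector_derivative_def .
    show "\<forall>\<^sub>F n in sequentially. \<forall>x\<in>{0..1}. \<forall>t. norm (t *\<^sub>R ?D n x - t *\<^sub>R d x) \<le> e * norm t"
      if e: "e > 0" for e
    proof -
      obtain N where "\<forall>n x. N \<le> n \<and> x \<in> {0..1} \<longrightarrow> dist (?D n x) (d x) < e"
        using d[OF e] by blast
      then have N: "norm (?D n x - d x) \<le> e" if "N \<le> n" "x \<in> {0..1}" for n x
        using that by (simp add: dist_norm less_imp_le)
      have "norm (t *\<^sub>R ?D n x - t *\<^sub>R d x) \<le> e * norm t" if "N \<le> n" "x \<in> {0..1}" for n x t
        using mult_left_mono[OF N[OF that], of "\<bar>t\<bar>"]
        by (simp add: scaleR_diff_right[symmetric] mult.commute)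
      then show ?thesis
        unfolding eventually_sequentially by blast
    qed
    show "(0::real) \<in> {0..1}" and "(\<lambda>n. apply_c1 (X n) 0) \<longlonglongrightarrow> h 0"
      using lim_h by auto
  qed simp
  then obtain g where g: "\<And>x. x \<in> {0..1} \<Longrightarrow> (\<lambda>n. apply_c1 (X n) x) \<longlonglongrightarrow> g x"
      "\<And>x. x \<in> {0..1} \<Longrightarrow> (g has_vector_derivative d x) (at x within {0..1})"
    unfolding has_vector_derivative_def by blast
  have gh: "g x = h x" if "x \<in> {0..1}" for x
    using LIMSEQ_unique[OF g(1)[OF that] lim_h[OF that]] .
  let ?g = "\<lambda>x. if x \<in> {0..1} then g x else 0"
  have deriv_g: "(?g has_vector_derivative d x) (at x within {0..1})" if "x \<in> {0..1}" for x
    using that g(2)[OF that] by (rule has_vector_derivative_extend0)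
  have "C1_on01 ?g"
    using deriv_g cont_d by (rule C1_on01I)
  then have app: "apply_c1 (Abs_c1 ?g) = ?g"
    by (intro Abs_c1_inverse) auto
  have "X \<longlonglongrightarrow> Abs_c1 ?g"
  proof (rule LIMSEQ_I)
    fix e :: real
    assume "e > 0"
    then obtain M N
      where M: "\<forall>n x. M \<le> n \<and> x \<in> {0..1} \<longrightarrow> dist (apply_c1 (X n) x) (h x) < e / 3"
        and N: "\<forall>n x. N \<le> n \<and> x \<in> {0..1} \<longrightarrow> dist (?D n x) (d x) < e / 3"
      using h[of "e / 3"] d[of "e / 3"] by auto
    have "norm (X n - Abs_c1 ?g) < e" if "max M N \<le> n" for n
    proof -
      have "norm (X n - Abs_c1 ?g) \<le> e / 3 + e / 3"
      proof (rule norm_c1_le)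
        fix x :: real
        assume x: "x \<in> {0..1}"
        show "cmod (apply_c1 (X n - Abs_c1 ?g) x) \<le> e / 3"
          using M[rule_format, of n x] that x gh[OF x]
          unfolding minus_c1.rep_eq app by (simp add: dist_norm less_imp_le)
        show "cmod (deriv01 (apply_c1 (X n - Abs_c1 ?g)) x) \<le> e / 3"
          using N[rule_format, of n x] that x
          unfolding deriv01_minus[OF x] app deriv01_eqI[OF x deriv_g[OF x]]
          by (simp add: dist_norm less_imp_le)
      qed
      then show ?thesis
        using \<open>e > 0\<close> by linarith
    qed
    then show "\<exists>no. \<forall>n\<ge>no. norm (X n - Abs_c1 ?g) < e"
      by blast
  qed
  then show "convergent X"
    by (rule convergentI)
qed

instance c1 :: complex_banach_algebra_1
proof
  show "norm (a *\<^sub>C f) = cmod a * norm f" for a and f :: c1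
    by (rule norm_scaleC_c1)
qed (unfold scaleR_c1_def, (transfer; simp add: fun_eq_iff algebra_simps)+)

end

theory Submission
  imports Defs
begin

text \<open>
  Write \<open>1 + it\<close> for the function \<open>t \<mapsto> 1 + i t\<close> and let \<open>x \<in> [0,1]\<close> be the point with
  \<open>\<phi>(1 + it) = 1 + ix\<close>. If \<open>g\<close> is real-valued then so is \<open>\<phi>(g)\<close>, and
  \<open>\<phi>(g)(1 + ix) = \<phi>(g(1 + it)) = g(s)(1 + is)\<close> for some \<open>s\<close>; comparing real and imaginary parts,
  \<open>\<phi>(g)\<close> is \<open>0\<close> or \<open>g(x)\<close>. For \<open>g = f f\<^sup>*\<close>, where \<open>f\<^sup>*\<close> is the pointwise conjugate,
  either (ii) or (iii) excludes \<open>\<phi>(g) = 0 \<noteq> g(x)\<close>: under (ii), \<open>g\<close> is the limit of the strictly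
  positive functions \<open>g + \<epsilon>\<close>; under (iii), \<open>g\<close> and \<open>(t - x)\<^sup>2\<close> would be two elements of the kernel
  with invertible sum. So \<open>\<phi>(f) \<phi>(f\<^sup>*) = \<bar>f(x)\<bar>\<^sup>2\<close>. Finally, dividing \<open>f\<close> by the positive function
  \<open>\<bar>f\<bar>\<^sup>2 + \<bar>f(x)\<bar>\<^sup>2 + (t - x)\<^sup>2\<close> yields a function whose modulus has a strict maximum at \<open>x\<close>.
  Hence \<open>\<bar>\<phi>(f)\<bar> \<le> \<bar>f(x)\<bar>\<close>, with equality only if \<open>\<phi>(f) = f(x)\<close>; the same bound for \<open>f\<^sup>*\<close>
  forces equality. If \<open>f(x) = 0\<close>, add \<open>e\<^sup>2\<close> with \<open>e \<rightarrow> 0\<close> to the divisor instead of \<open>\<bar>f(x)\<bar>\<^sup>2\<close>.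
\<close>

section \<open>Inverses, spectra and point evaluations in the algebra\<close>

lemma c1_eqI:
  assumes "\<And>t. t \<in> {0..1} \<Longrightarrow> apply_c1 f t = apply_c1 g t"
  shows "f = g"
  using assms apply_c1_outside by (metis apply_c1_inject ext)

lemma apply_c1_one: "t \<in> {0..1} \<Longrightarrow> apply_c1 1 t = 1"
  by (simp add: one_c1.rep_eq)

lemmas apply_c1_simps =
  plus_c1.rep_eq minus_c1.rep_eq times_c1.rep_eq scaleC_c1.rep_eq zero_c1.rep_eq apply_c1_one

lift_definition cnj_c1 :: "c1 \<Rightarrow> c1" is "\<lambda>f t. cnj (f t)"
proof safe
  fix f :: "real \<Rightarrow> complex"
  assume "C1_on01 f"
  then show "C1_on01 (\<lambda>t. cnj (f t))"
    using C1_on01_has_deriv C1_on01_continuous_deriv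
    by (intro C1_on01I[where d = "\<lambda>t. cnj (deriv01 f t)"] has_vector_derivative_cnj
        continuous_on_cnj)
qed simp

lift_definition ident_c1 :: c1 is "\<lambda>t. if t \<in> {0..1} then complex_of_real t else 0"
proof safe
  show "C1_on01 (\<lambda>t. if t \<in> {0..1} then complex_of_real t else 0)"
    by (intro C1_on01I[where d = "\<lambda>t. of_real 1"] has_vector_derivative_extend0
        has_vector_derivative_of_real DERIV_ident continuous_on_const)
qed auto

lemma apply_ident_c1: "t \<in> {0..1} \<Longrightarrow> apply_c1 ident_c1 t = complex_of_real t"
  by (simp add: ident_c1.rep_eq)

lemma apply_c1_of_real: "t \<in> {0..1} \<Longrightarrow> apply_c1 (of_real r) t = of_real r"
  by (simp add: of_real_def[where 'a = c1] scaleR_c1_def apply_c1_simps)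

lemma invertible_c1:
  assumes "\<And>t. t \<in> {0..1} \<Longrightarrow> apply_c1 f t \<noteq> 0"
  obtains g where "f * g = 1"
proof -
  let ?g = "\<lambda>t. if t \<in> {0..1} then inverse (apply_c1 f t) else 0"
  have "C1_on01 ?g"
  proof (rule C1_on01I)
    fix t :: real
    assume t: "t \<in> {0..1}"
    have "((\<lambda>t. inverse (apply_c1 f t)) has_vector_derivative
            deriv01 (apply_c1 f) t * - (inverse (apply_c1 f t) * inverse (apply_c1 f t)))
            (at t within {0..1})"
      using field_vector_diff_chain_within[OF has_deriv_c1[OF t]
          DERIV_inverse[OF assms[OF t], THEN has_field_derivative_at_within]]
      by (simp add: o_def power2_eq_square numeral_2_eq_2)
    then show "(?g has_vector_derivative
            deriv01 (apply_c1 f) t * - (inverse (apply_c1 f t) * inverse (apply_c1 f t)))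
            (at t within {0..1})"
      by (rule has_vector_derivative_extend0[OF t])
  qed (use assms in \<open>intro continuous_intros continuous_apply_c1 continuous_deriv_c1; auto\<close>)
  then have "apply_c1 (Abs_c1 ?g) = ?g"
    by (intro Abs_c1_inverse) auto
  then have "f * Abs_c1 ?g = 1"
    using assms by (intro c1_eqI) (simp add: apply_c1_simps)
  then show thesis
    by (rule that)
qed

text \<open>If \<open>f - z\<close> has no zero on [0,1], its pointwise inverse is again C^1;
  commutativity makes it two-sided.\<close>

lemma spectrum_c1_subset:
  assumes "z \<in> spectrum f"
  obtains t where "t \<in> {0..1}" "z = apply_c1 f t"
proof -
  have "\<exists>t\<in>{0..1}. apply_c1 (f - z *\<^sub>C 1) t = 0"
  proof (rule ccontr)
    assume "\<not> ?thesis"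
    then obtain g where "(f - z *\<^sub>C 1) * g = 1"
      by (metis invertible_c1)
    then show False
      using assms by (auto simp: spectrum_def mult.commute)
  qed
  then show thesis
    using that by (auto simp: apply_c1_simps)
qed

lemma apply_c1_linear: "Vector_Spaces.linear scaleC (*) (\<lambda>f. apply_c1 f x)"
proof -
  interpret complex_mult: vector_space "(*) :: complex \<Rightarrow> complex \<Rightarrow> complex"
    by unfold_locales (simp_all add: algebra_simps)
  show ?thesis
    by unfold_locales (simp_all add: apply_c1_simps)
qed

lemma character_apply_c1: "x \<in> {0..1} \<Longrightarrow> character (\<lambda>f. apply_c1 f x)"
  unfolding character_def multiplicative_def
  using apply_c1_linear by (auto simp: times_c1.rep_eq intro!: exI[of _ 1] simp: apply_c1_one)

text \<open>The kernel of a linear map is its own span, and \<open>\<phi> 1 = 0\<close> would make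
  \<open>\<phi> f = \<phi> 1 * \<phi> f\<close> vanish for every \<open>f\<close>.\<close>

lemma one_notin_cspan_ker:
  assumes "character \<phi>"
  shows "1 \<notin> cspan (ker \<phi>)"
proof
  interpret Vector_Spaces.linear scaleC "(*)" \<phi>
    using assms by (simp add: character_def)
  assume "1 \<in> cspan (ker \<phi>)"
  moreover have "cspan (ker \<phi>) \<subseteq> ker \<phi>"
    by (intro complex_vector.span_minimal complex_vector.subspaceI)
      (simp_all add: ker_def add scale)
  ultimately have "\<phi> 1 = 0"
    by (auto simp: ker_def)
  then have "\<phi> f = 0" for f
    using assms by (metis character_def mult_1 multiplicative_def mult_zero_left)
  then show False
    using assms by (auto simp: character_def)
qed

section \<open>The distinguished point and the values on real-valued functions\<close>

locale multiplicative_spectral =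
  fixes \<phi> :: "c1 \<Rightarrow> complex"
  assumes multiplicative: "multiplicative \<phi>" and spectral: "spectral \<phi>"
begin

lemma mult: "\<phi> (f * g) = \<phi> f * \<phi> g"
  using multiplicative by (simp add: multiplicative_def)

lemma value_attained:
  obtains s where "s \<in> {0..1}" "\<phi> f = apply_c1 f s"
  using spectral spectrum_c1_subset unfolding spectral_def by metis

lemma norm_le: "cmod (\<phi> f) \<le> norm f"
  using value_attained[of f] norm_apply_c1 by metis

lemma continuous_if_character:
  assumes "character \<phi>"
  shows "continuous_on UNIV \<phi>"
proof -
  interpret Vector_Spaces.linear scaleC "(*)" \<phi>
    using assms by (simp add: character_def)
  have "1-lipschitz_on UNIV \<phi>"
    by (rule lipschitz_onI) (simp_all add: dist_norm diff[symmetric] norm_le)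
  then show ?thesis
    by (rule lipschitz_on_continuous_on)
qed

text \<open>The point at which \<open>\<phi>\<close> evaluates if it is a character.\<close>

definition point :: real where
  "point = Im (\<phi> (1 + \<i> *\<^sub>C ident_c1))"

lemma point: "point \<in> {0..1}" "\<phi> (1 + \<i> *\<^sub>C ident_c1) = 1 + \<i> * point"
proof -
  obtain s :: real where "s \<in> {0..1}" "\<phi> (1 + \<i> *\<^sub>C ident_c1) = 1 + \<i> * of_real s"
    by (rule value_attained[of "1 + \<i> *\<^sub>C ident_c1"])
      (simp add: apply_c1_simps apply_ident_c1)
  then show "point \<in> {0..1}" "\<phi> (1 + \<i> *\<^sub>C ident_c1) = 1 + \<i> * point"
    by (simp_all add: point_def)
qed

lemma value_real:
  assumes "\<And>t. t \<in> {0..1} \<Longrightarrow> apply_c1 g t \<in> \<real>" and "\<phi> g \<noteq> 0"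
  shows "\<phi> g = apply_c1 g point"
proof -
  obtain r where r: "\<phi> g = complex_of_real r"
    using value_attained[of g] assms(1) by (metis Reals_cases)
  obtain s where s: "s \<in> {0..1}"
      "\<phi> (g * (1 + \<i> *\<^sub>C ident_c1)) = apply_c1 g s * (1 + \<i> * of_real s)"
    by (rule value_attained[of "g * (1 + \<i> *\<^sub>C ident_c1)"])
      (simp add: apply_c1_simps apply_ident_c1)
  obtain r' where r': "apply_c1 g s = complex_of_real r'"
    using assms(1) s(1) by (metis Reals_cases)
  \<comment> \<open>The factor \<open>1 + \<i> * t\<close> has constant real part 1: real parts give
    the first equation, imaginary parts the second.\<close>
  have "r = r'" "r * point = r' * s"
    using s(2) unfolding mult point(2) r r' by (auto simp: complex_eq_iff)
  moreover have "r \<noteq> 0"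
    using assms(2) r by simp
  ultimately have "point = s"
    by (metis mult_cancel_left)
  with r r' \<open>r = r'\<close> show ?thesis
    by simp
qed

lemma value_real_nonvanishing:
  assumes "\<And>t. t \<in> {0..1} \<Longrightarrow> apply_c1 g t \<in> \<real> - {0}"
  shows "\<phi> g = apply_c1 g point"
  using assms by (metis Diff_iff singletonI value_attained value_real)

text \<open>On [0,1] this vanishes only at \<open>point\<close>. It serves to remove zeros from a
  sum of squares and to make a maximum of a modulus strict.\<close>

definition sq_dist :: c1 where
  "sq_dist = (ident_c1 - of_real point) * (ident_c1 - of_real point)"

lemma apply_sq_dist: "t \<in> {0..1} \<Longrightarrow> apply_c1 sq_dist t = of_real ((t - point)\<^sup>2)"
  by (simp add: sq_dist_def times_c1.rep_eq minus_c1.rep_eq apply_ident_c1 apply_c1_of_real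
      power2_eq_square)

lemma apply_mult_cnj: "apply_c1 (f * cnj_c1 f) t = of_real ((cmod (apply_c1 f t))\<^sup>2)"
  by (simp add: times_c1.rep_eq cnj_c1.rep_eq complex_norm_square[symmetric] del: of_real_power)

section \<open>The values on squared moduli, under either condition\<close>

lemma value_mult_cnj_if_continuous:
  assumes "continuous_on UNIV \<phi>"
  shows "\<phi> (f * cnj_c1 f) = of_real ((cmod (apply_c1 f point))\<^sup>2)"
proof -
  let ?g = "\<lambda>e. f * cnj_c1 f + of_real e" and ?a = "cmod (apply_c1 f point)"
  have "continuous_on UNIV (\<phi> \<circ> ?g)"
    by (intro continuous_on_compose continuous_intros continuous_on_subset[OF assms]) auto
  then have "((\<phi> \<circ> ?g) \<longlongrightarrow> (\<phi> \<circ> ?g) 0) (at_right 0)"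
    by (metis continuous_on_def UNIV_I tendsto_within_subset subset_UNIV)
  \<comment> \<open>At \<open>e = 0\<close> the function may have zeros, so its value is known only
    for \<open>e > 0\<close> and is then carried to 0 by continuity.\<close>
  moreover have "(\<phi> \<circ> ?g) e = of_real (?a\<^sup>2 + e)" if "e > 0" for e
  proof -
    have ap: "apply_c1 (?g e) t = of_real ((cmod (apply_c1 f t))\<^sup>2 + e)" if "t \<in> {0..1}" for t
      using that by (simp add: plus_c1.rep_eq apply_mult_cnj apply_c1_of_real)
    have "(cmod (apply_c1 f t))\<^sup>2 + e \<noteq> 0" for t
      using \<open>e > 0\<close> add_nonneg_pos[of "(cmod (apply_c1 f t))\<^sup>2" e] by simp
    then have "apply_c1 (?g e) t \<in> \<real> - {0}" if "t \<in> {0..1}" for t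
      unfolding ap[OF that] by (metis Diff_iff Reals_of_real of_real_eq_0_iff singletonD)
    then show ?thesis
      using value_real_nonvanishing by (simp add: ap[OF point(1)])
  qed
  then have "\<forall>\<^sub>F e in at_right 0. (\<phi> \<circ> ?g) e = of_real (?a\<^sup>2 + e)"
    by (intro eventually_mono[OF eventually_at_right_less]) blast
  ultimately have "((\<lambda>e. complex_of_real (?a\<^sup>2 + e)) \<longlongrightarrow> (\<phi> \<circ> ?g) 0) (at_right 0)"
    by (rule Lim_transform_eventually)
  moreover have "((\<lambda>e. complex_of_real (?a\<^sup>2 + e)) \<longlongrightarrow> of_real (?a\<^sup>2 + 0)) (at_right 0)"
    by (intro tendsto_intros)
  ultimately have "(\<phi> \<circ> ?g) 0 = of_real (?a\<^sup>2 + 0)"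
    by (rule tendsto_unique[OF trivial_limit_at_right_real])
  then show ?thesis
    by simp
qed

lemma value_mult_cnj_if_one_notin_cspan_ker:
  assumes "1 \<notin> cspan (ker \<phi>)"
  shows "\<phi> (f * cnj_c1 f) = of_real ((cmod (apply_c1 f point))\<^sup>2)"
proof (cases "\<phi> (f * cnj_c1 f) = 0")
  case False
  then show ?thesis
    using value_real[of "f * cnj_c1 f"] unfolding apply_mult_cnj by (metis Reals_of_real)
next
  case True
  \<comment> \<open>A nonzero value would have to equal \<open>sq_dist\<close> at
    \<open>point\<close>, which is 0.\<close>
  have "\<phi> sq_dist = 0"
    using value_real[of sq_dist] point(1) by (force simp: apply_sq_dist)
  have "apply_c1 f point = 0"
  proof (rule ccontr)
    assume nz: "apply_c1 f point \<noteq> 0"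
    have "apply_c1 (f * cnj_c1 f + sq_dist) t \<noteq> 0" if t: "t \<in> {0..1}" for t
    proof -
      \<comment> \<open>The first square is nonzero at \<open>point\<close>, the second everywhere
        else.\<close>
      have "(cmod (apply_c1 f t))\<^sup>2 + (t - point)\<^sup>2 \<noteq> 0"
        using nz by auto
      then show ?thesis
        unfolding plus_c1.rep_eq apply_mult_cnj apply_sq_dist[OF t]
        by (metis of_real_add of_real_eq_0_iff)
    qed
    then obtain k where k: "(f * cnj_c1 f + sq_dist) * k = 1"
      using invertible_c1 by blast
    have "f * cnj_c1 f * k \<in> ker \<phi>" "sq_dist * k \<in> ker \<phi>"
      using True \<open>\<phi> sq_dist = 0\<close> mult by (simp_all add: ker_def)
    then have "f * cnj_c1 f * k + sq_dist * k \<in> cspan (ker \<phi>)"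
      by (intro complex_vector.span_add complex_vector.span_base)
    with k assms show False
      by (simp add: distrib_right)
  qed
  with True show ?thesis
    by simp
qed

section \<open>Values on arbitrary functions through peaking quotients\<close>

lemma value_attained_quotient:
  fixes e :: real
  assumes e: "e > 0"
  obtains s where "s \<in> {0..1}"
    and "\<phi> f * of_real ((cmod (apply_c1 f s))\<^sup>2 + e\<^sup>2 + (s - point)\<^sup>2) =
           apply_c1 f s * of_real ((cmod (apply_c1 f point))\<^sup>2 + e\<^sup>2)"
proof -
  \<comment> \<open>The claim is \<open>\<phi> (f / q) = (f / q) s\<close> cleared of denominators:
    \<open>q\<close> is positive, so its value is \<open>q\<close> at \<open>point\<close>, where
    \<open>sq_dist\<close> drops out.\<close>
  define q where "q = f * cnj_c1 f + of_real (e\<^sup>2) + sq_dist"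
  have ap: "apply_c1 q t = of_real ((cmod (apply_c1 f t))\<^sup>2 + e\<^sup>2 + (t - point)\<^sup>2)"
    if "t \<in> {0..1}" for t
    using that by (simp add: q_def plus_c1.rep_eq apply_mult_cnj apply_c1_of_real apply_sq_dist
        del: of_real_power)
  have "(cmod (apply_c1 f t))\<^sup>2 + e\<^sup>2 + (t - point)\<^sup>2 \<noteq> 0" for t
    using e by (smt (verit) zero_le_power2 zero_less_power)
  then have nz: "apply_c1 q t \<in> \<real> - {0}" if "t \<in> {0..1}" for t
    unfolding ap[OF that] by (metis Diff_iff Reals_of_real of_real_eq_0_iff singletonD)
  then have q: "\<phi> q = apply_c1 q point"
    by (rule value_real_nonvanishing)
  obtain k where k: "q * k = 1"
    using invertible_c1[of q] nz by blast
  obtain s where s: "s \<in> {0..1}" "\<phi> (f * k) = apply_c1 (f * k) s"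
    by (rule value_attained)
  have "\<phi> f = \<phi> (f * k) * \<phi> q"
    using k by (metis mult mult.assoc mult.commute mult_1_right)
  moreover have "apply_c1 f s = apply_c1 (f * k) s * apply_c1 q s"
    using k by (metis times_c1.rep_eq mult.assoc mult.commute mult_1_right)
  ultimately have "\<phi> f * apply_c1 q s = apply_c1 f s * apply_c1 q point"
    using s(2) q by (simp add: mult_ac)
  with s(1) show thesis
    using that by (simp add: ap[OF s(1)] ap[OF point(1)] del: of_real_add of_real_power)
qed

text \<open>The quotient has modulus at most \<open>m / (m\<^sup>2 + e\<^sup>2)\<close>, where
  \<open>m\<close> is the modulus of \<open>f\<close> at \<open>s\<close>, and this never exceeds
  \<open>1 / (2 * e)\<close>.\<close>

lemma norm_value_le:
  assumes e: "e > 0"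
  shows "cmod (\<phi> f) \<le> ((cmod (apply_c1 f point))\<^sup>2 + e\<^sup>2) / (2 * e)"
proof -
  let ?c = "(cmod (apply_c1 f point))\<^sup>2 + e\<^sup>2"
  obtain s where s: "s \<in> {0..1}"
      "\<phi> f * of_real ((cmod (apply_c1 f s))\<^sup>2 + e\<^sup>2 + (s - point)\<^sup>2) = apply_c1 f s * of_real ?c"
    by (rule value_attained_quotient[OF e])
  let ?m = "cmod (apply_c1 f s)"
  have pos: "?m\<^sup>2 + e\<^sup>2 > 0"
    using e by (simp add: add_nonneg_pos)
  have "cmod (\<phi> f) * (?m\<^sup>2 + e\<^sup>2) \<le> cmod (\<phi> f) * (?m\<^sup>2 + e\<^sup>2 + (s - point)\<^sup>2)"
    by (intro mult_left_mono) simp_all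
  also have "\<dots> = ?m * ?c"
    using arg_cong[OF s(2), of cmod] unfolding norm_mult norm_of_real by simp
  finally have "cmod (\<phi> f) * (2 * e) * (?m\<^sup>2 + e\<^sup>2) \<le> (2 * ?m * e) * ?c"
    using e by (simp add: mult_ac)
  also have "\<dots> \<le> (?m\<^sup>2 + e\<^sup>2) * ?c"
    by (intro mult_right_mono sum_squares_bound) simp
  finally have "cmod (\<phi> f) * (2 * e) \<le> ?c"
    using pos by (simp add: mult.commute)
  then show ?thesis
    using e by (simp add: field_simps)
qed

lemma value_eq_apply:
  assumes sq: "\<And>f. \<phi> (f * cnj_c1 f) = of_real ((cmod (apply_c1 f point))\<^sup>2)"
  shows "\<phi> f = apply_c1 f point"
proof -
  let ?a = "cmod (apply_c1 f point)"
  show ?thesis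
  proof (cases "?a = 0")
    case True
    \<comment> \<open>When \<open>f\<close> vanishes at \<open>point\<close>, the bound reads
      \<open>e / 2\<close>.\<close>
    have "cmod (\<phi> f) \<le> 0 + e" if "e > 0" for e
      using norm_value_le[of e f] True that by (simp add: power2_eq_square)
    then have "cmod (\<phi> f) \<le> 0"
      by (rule field_le_epsilon)
    with True show ?thesis
      by simp
  next
    case False
    then have a: "?a > 0"
      by simp
    \<comment> \<open>The choice \<open>e = ?a\<close> minimises the bound and makes it exactly
      \<open>?a\<close>; conjugation leaves \<open>?a\<close> unchanged.\<close>
    have le: "cmod (\<phi> f) \<le> ?a" "cmod (\<phi> (cnj_c1 f)) \<le> ?a"
      using norm_value_le[OF a, of f] norm_value_le[OF a, of "cnj_c1 f"] a
      by (simp_all add: cnj_c1.rep_eq power2_eq_square)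
    have "cmod (\<phi> f) * cmod (\<phi> (cnj_c1 f)) = ?a * ?a"
      using sq[of f] by (simp add: mult norm_mult[symmetric] norm_power power2_eq_square)
    moreover have "cmod (\<phi> f) * cmod (\<phi> (cnj_c1 f)) < ?a * ?a" if "cmod (\<phi> f) < ?a"
      using mult_left_mono[OF le(2), of "cmod (\<phi> f)"] mult_strict_right_mono[OF that a] by simp
    ultimately have eq: "cmod (\<phi> f) = ?a"
      using le(1) by linarith
    obtain s where s: "s \<in> {0..1}"
        "\<phi> f * of_real ((cmod (apply_c1 f s))\<^sup>2 + ?a\<^sup>2 + (s - point)\<^sup>2) =
           apply_c1 f s * of_real (?a\<^sup>2 + ?a\<^sup>2)"
      by (rule value_attained_quotient[OF a, of f])
    let ?m = "cmod (apply_c1 f s)"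
    have "cmod (\<phi> f) * (?m\<^sup>2 + ?a\<^sup>2 + (s - point)\<^sup>2) = ?m * (?a\<^sup>2 + ?a\<^sup>2)"
      using arg_cong[OF s(2), of cmod] unfolding norm_mult norm_of_real by simp
    \<comment> \<open>With modulus \<open>?a\<close> on the left, the two sides differ by
      \<open>?a\<close> times a sum of two squares, so both squares vanish.\<close>
    then have "?a * ((?m - ?a)\<^sup>2 + (s - point)\<^sup>2) = 0"
      unfolding eq by (simp add: power2_eq_square algebra_simps)
    then have "s = point"
      using a by auto
    with s(2) a show ?thesis
      by (auto simp del: of_real_add of_real_power)
  qed
qed

end

theorem corollary3p11:
  fixes \<phi> :: "c1 \<Rightarrow> complex"
  assumes "multiplicative \<phi>" and "spectral \<phi>"
  shows "(character \<phi> \<longleftrightarrow> continuous_on UNIV \<phi>) \<and>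
         (continuous_on UNIV \<phi> \<longleftrightarrow> 1 \<notin> cspan (ker \<phi>))"
proof -
  interpret multiplicative_spectral \<phi>
    using assms by unfold_locales
  have "character \<phi>" if "continuous_on UNIV \<phi> \<or> 1 \<notin> cspan (ker \<phi>)"
  proof -
    \<comment> \<open>Either condition enters only through the formula for
      \<open>\<phi> (f * cnj_c1 f)\<close>.\<close>
    have "\<phi> = (\<lambda>f. apply_c1 f point)"
      using that value_eq_apply value_mult_cnj_if_continuous
        value_mult_cnj_if_one_notin_cspan_ker by blast
    then show ?thesis
      using character_apply_c1[OF point(1)] by simp
  qed
  then show ?thesis
    using continuous_if_character one_notin_cspan_ker by blast
qed

end
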